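(* With the notation of the context and $h\le h_0$, all generalized eigenvalues $\lambda\in\mathbb{C}$ of the block Jacobi preconditioned problem $$\begin{bmatrix} H_T & M_1 \\ M_2 & H_P \end{bmatrix}\begin{bmatrix} T \\ P \end{bmatrix}=\lambda\begin{bmatrix} H_T & 0 \\ 0 & H_P \end{bmatrix}\begin{bmatrix} T \\ P \end{bmatrix},\qquad \begin{bmatrix} T \\ P \end{bmatrix}\neq0,$$ are contained in the ball of radius $\sqrt{C_TC_P(\gamma-1)\left|1-\tfrac{\Lambda}{\mathcal{M}}\right|}$ around $1$.
   Context: $\Omega\subset\mathbb{R}^d$ ($d=2,3$) is a bounded domain with $\partial\Omega=\Gamma_a\cup\Gamma_w$; $\mathcal{V}_h\subset H^1(\Omega)$ is the complex-valued space of continuous piecewise polynomials of some fixed degree $k\ge 1$ on a conforming quasiuniform triangulation of mesh size $h$, with basis $\{\psi_\imath\}_{\imath=1}^{\dim\mathcal{V}_h}$. $(f,g)=\int_\Omega f\overline g\,dx$, $\langle f,g\rangle_{\Gamma_a}=\int_{\Gamma_a}f\overline g\,ds$, $\|\cdot\|$ is the $L^2(\Omega)$ norm. Parameters: $\gamma>1$, $\mathcal{M}>0$, $\Lambda>0$, with $\Lambda\ne\mathcal{M}$. Matrices: mass matrix $M_{\imath\jmath}=(\psi_\jmath,\psi_\imath)$, stiffness matrix $K_{\imath\jmath}=(\nabla\psi_\jmath,\nabla\psi_\imath)$, $K^\gamma_{\imath\jmath}=(\nabla\psi_\jmath,\nabla\psi_\imath)-i\sqrt\gamma\langle\psi_\jmath,\psi_\imath\rangle_{\Gamma_a}$,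 $$H_T=\mathcal{M}K-iM,\quad H_P=(1-i\gamma\Lambda)K^\gamma-\Big[\gamma\big(1-\tfrac{\Lambda}{\mathcal{M}}\big)-\tfrac{\Lambda}{\mathcal{M}}\Big]M,\quad M_1=i\tfrac{\gamma-1}{\gamma}M,\quad M_2=\gamma\big(1-\tfrac{\Lambda}{\mathcal{M}}\big)M.$$ $\mathcal{A}_{T,h},\mathcal{A}_{P,h}:\mathcal{V}_h\to\mathcal{V}_h'$ are the operators associated with the sesquilinear forms of $H_T$ and $H_P$. Standing assumption: for $h\le h_0$ these operators are invertible, and $C_T,C_P$ are constants independent of $h$ with $\|\mathcal{A}_{T,h}^{-1}\|\le C_T$ and $\|\mathcal{A}_{P,h}^{-1}\|\le C_P$, where the operator norms are taken with respect to the $L^2$ norm on $\mathcal{V}_h$ and the corresponding dual norm on $\mathcal{V}_h'$; equivalently $\|H_T^{-1}M\|_M\le C_T$ and $\|H_P^{-1}M\|_M\le C_P$, where $\|\cdot\|_M$ is the matrix norm induced by the vector norm $\|\mathrm{u}\|_M=(\mathrm{u}^*M\mathrm{u})^{1/2}$. *)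

theory Defs
  imports "HOL-Analysis.Analysis" "Jordan_Normal_Form.Matrix"
begin

section \<open>Surface measure\<close>

text \<open>
  The \<open>m\<close>-dimensional Hausdorff outer measure, normalised so that on \<open>m\<close>-dimensional affine
  subspaces it is Lebesgue measure. The covering sets are required to be bounded because
  \<^const>\<open>diameter\<close> is meaningless on unbounded sets.
\<close>

definition hausdorff_pre :: "nat \<Rightarrow> real \<Rightarrow> 'a::metric_space set \<Rightarrow> ennreal" where
  "hausdorff_pre m \<delta> A =
     (INF U \<in> {U :: nat \<Rightarrow> 'a set. A \<subseteq> (\<Union>i. U i) \<and> (\<forall>i. bounded (U i) \<and> diameter (U i) \<le> \<delta>)}.
        \<Sum>i. ennreal (unit_ball_vol (real m) / 2 ^ m * diameter (U i) ^ m))"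

definition hausdorff_outer :: "nat \<Rightarrow> 'a::metric_space set \<Rightarrow> ennreal" where
  "hausdorff_outer m A = (SUP \<delta>\<in>{0<..}. hausdorff_pre m \<delta> A)"

definition surface_measure :: "'a::euclidean_space measure" where
  "surface_measure = measure_of UNIV (sets borel) (hausdorff_outer (DIM('a) - 1))"


section \<open>Triangulations and Lagrange finite elements\<close>

text \<open>
  The library predicate \<^const>\<open>triangulation\<close> says that the finitely many simplices meet only in common
  faces, which is conformity. The condition \<open>\<Omega> = interior (\<Union>\<T>)\<close> makes \<open>\<Omega>\<close> a polyhedral domain
  whose whole boundary is resolved by the mesh.
\<close>

definition triangulation_of :: "'a::euclidean_space set \<Rightarrow> 'a set set \<Rightarrow> bool" where
  "triangulation_of \<Omega> \<T> \<longleftrightarrow>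
     triangulation \<T> \<and> (\<forall>K\<in>\<T>. int DIM('a) simplex K) \<and>
     closure \<Omega> = \<Union>\<T> \<and> \<Omega> = interior (\<Union>\<T>)"

definition mesh_size :: "'a::euclidean_space set set \<Rightarrow> real" where
  "mesh_size \<T> = Max (diameter ` \<T>)"

definition quasi_uniform :: "'a::euclidean_space set set set \<Rightarrow> bool" where
  "quasi_uniform \<TT> \<longleftrightarrow> (\<exists>\<rho>>0. \<forall>\<T>\<in>\<TT>. \<forall>K\<in>\<T>. \<exists>x. cball x (\<rho> * mesh_size \<T>) \<subseteq> K)"

text \<open>Complex polynomials in the coordinates of total degree at most \<open>k\<close>.\<close>

definition multi_indices :: "nat \<Rightarrow> ('a::euclidean_space \<Rightarrow> nat) set" where
  "multi_indices k = {\<alpha> \<in> Basis \<rightarrow>\<^sub>E {..k}. (\<Sum>b\<in>Basis. \<alpha> b) \<le> k}"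

definition polynomials :: "nat \<Rightarrow> ('a::euclidean_space \<Rightarrow> complex) set" where
  "polynomials k =
     {p. \<exists>c. \<forall>x. p x = (\<Sum>\<alpha>\<in>multi_indices k. c \<alpha> * (\<Prod>b\<in>Basis. complex_of_real (x \<bullet> b) ^ \<alpha> b))}"

text \<open>
  Functions on \<open>closure \<Omega>\<close> are represented by total functions vanishing outside \<open>closure \<Omega>\<close>, so that
  equality of elements is equality of functions.
\<close>

definition fe_space ::
  "nat \<Rightarrow> 'a::euclidean_space set \<Rightarrow> 'a set set \<Rightarrow> ('a \<Rightarrow> complex) set" where
  "fe_space k \<Omega> \<T> =
     {u. continuous_on (closure \<Omega>) u \<and> (\<forall>x. x \<notin> closure \<Omega> \<longrightarrow> u x = 0) \<and>
         (\<forall>K\<in>\<T>. \<exists>p\<in>polynomials k. \<forall>x\<in>K. u x = p x)}"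

definition is_basis :: "('a \<Rightarrow> complex) set \<Rightarrow> nat \<Rightarrow> (nat \<Rightarrow> 'a \<Rightarrow> complex) \<Rightarrow> bool" where
  "is_basis V n \<psi> \<longleftrightarrow>
     (\<forall>i<n. \<psi> i \<in> V) \<and>
     (\<forall>c. (\<forall>x. (\<Sum>i<n. c i * \<psi> i x) = 0) \<longrightarrow> (\<forall>i<n. c i = 0)) \<and>
     (\<forall>u\<in>V. \<exists>c. \<forall>x. u x = (\<Sum>i<n. c i * \<psi> i x))"


section \<open>Sesquilinear forms\<close>

definition l2_inner :: "'a::euclidean_space set \<Rightarrow> ('a \<Rightarrow> complex) \<Rightarrow> ('a \<Rightarrow> complex) \<Rightarrow> complex" where
  "l2_inner \<Omega> f g = set_lebesgue_integral lebesgue \<Omega> (\<lambda>x. f x * cnj (g x))"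

definition l2_norm :: "'a::euclidean_space set \<Rightarrow> ('a \<Rightarrow> complex) \<Rightarrow> real" where
  "l2_norm \<Omega> f = sqrt (Re (l2_inner \<Omega> f f))"

text \<open>
  The weak gradient of a continuous piecewise polynomial function is its classical gradient in the
  interiors of the simplices, hence almost everywhere. The integral is over the complete measure
  \<^const>\<open>lebesgue\<close> because \<^const>\<open>frechet_derivative\<close> is an arbitrary value on the remaining
  null set.
\<close>

definition grad_inner :: "'a::euclidean_space set \<Rightarrow> ('a \<Rightarrow> complex) \<Rightarrow> ('a \<Rightarrow> complex) \<Rightarrow> complex" where
  "grad_inner \<Omega> f g = set_lebesgue_integral lebesgue \<Omega>
     (\<lambda>x. \<Sum>b\<in>Basis. frechet_derivative f (at x) b * cnj (frechet_derivative g (at x) b))"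

definition bdry_inner :: "'a::euclidean_space set \<Rightarrow> ('a \<Rightarrow> complex) \<Rightarrow> ('a \<Rightarrow> complex) \<Rightarrow> complex" where
  "bdry_inner \<Gamma> f g = set_lebesgue_integral surface_measure \<Gamma> (\<lambda>x. f x * cnj (g x))"

definition grad_inner_gamma ::
  "real \<Rightarrow> 'a::euclidean_space set \<Rightarrow> 'a set \<Rightarrow> ('a \<Rightarrow> complex) \<Rightarrow> ('a \<Rightarrow> complex) \<Rightarrow> complex" where
  "grad_inner_gamma \<gamma> \<Omega> \<Gamma> f g =
     grad_inner \<Omega> f g - \<i> * complex_of_real (sqrt \<gamma>) * bdry_inner \<Gamma> f g"

definition form_T ::
  "real \<Rightarrow> 'a::euclidean_space set \<Rightarrow> ('a \<Rightarrow> complex) \<Rightarrow> ('a \<Rightarrow> complex) \<Rightarrow> complex" where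
  "form_T \<M> \<Omega> f g = complex_of_real \<M> * grad_inner \<Omega> f g - \<i> * l2_inner \<Omega> f g"

definition form_P ::
  "real \<Rightarrow> real \<Rightarrow> real \<Rightarrow> 'a::euclidean_space set \<Rightarrow> 'a set \<Rightarrow> ('a \<Rightarrow> complex) \<Rightarrow> ('a \<Rightarrow> complex) \<Rightarrow> complex"
  where
  "form_P \<gamma> \<M> \<Lambda> \<Omega> \<Gamma> f g =
     (1 - \<i> * complex_of_real (\<gamma> * \<Lambda>)) * grad_inner_gamma \<gamma> \<Omega> \<Gamma> f g
       - complex_of_real (\<gamma> * (1 - \<Lambda> / \<M>) - \<Lambda> / \<M>) * l2_inner \<Omega> f g"


section \<open>Associated operators and their norms\<close>

text \<open>
  The dual of \<open>V\<close> consists of the antilinear functionals, since the forms are antilinear in the second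
  argument. Functionals are extensional on \<open>V\<close>. The norms take values in \<^typ>\<open>ennreal\<close>, so that
  no supremum is meaningless.
\<close>

definition antidual :: "('a \<Rightarrow> complex) set \<Rightarrow> (('a \<Rightarrow> complex) \<Rightarrow> complex) set" where
  "antidual V =
     {F \<in> extensional V.
        (\<forall>u\<in>V. \<forall>v\<in>V. F (\<lambda>x. u x + v x) = F u + F v) \<and>
        (\<forall>c. \<forall>v\<in>V. F (\<lambda>x. c * v x) = cnj c * F v)}"

definition assoc_op ::
  "('a \<Rightarrow> complex) set \<Rightarrow> (('a \<Rightarrow> complex) \<Rightarrow> ('a \<Rightarrow> complex) \<Rightarrow> complex) \<Rightarrow>
   ('a \<Rightarrow> complex) \<Rightarrow> (('a \<Rightarrow> complex) \<Rightarrow> complex)" where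
  "assoc_op V a u = (\<lambda>v\<in>V. a u v)"

definition dual_norm ::
  "'a::euclidean_space set \<Rightarrow> ('a \<Rightarrow> complex) set \<Rightarrow> (('a \<Rightarrow> complex) \<Rightarrow> complex) \<Rightarrow> ennreal" where
  "dual_norm \<Omega> V F = (SUP v\<in>V - {\<lambda>_. 0}. ennreal (cmod (F v) / l2_norm \<Omega> v))"

text \<open>The operator norm of a map from the dual of \<open>V\<close> to \<open>V\<close>.\<close>

definition dual_op_norm ::
  "'a::euclidean_space set \<Rightarrow> ('a \<Rightarrow> complex) set \<Rightarrow>
   ((('a \<Rightarrow> complex) \<Rightarrow> complex) \<Rightarrow> ('a \<Rightarrow> complex)) \<Rightarrow> ennreal" where
  "dual_op_norm \<Omega> V B =
     (SUP F\<in>antidual V - {\<lambda>v\<in>V. 0}. ennreal (l2_norm \<Omega> (B F)) / dual_norm \<Omega> V F)"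


section \<open>Matrices\<close>

definition form_mat ::
  "nat \<Rightarrow> (nat \<Rightarrow> 'a \<Rightarrow> complex) \<Rightarrow> (('a \<Rightarrow> complex) \<Rightarrow> ('a \<Rightarrow> complex) \<Rightarrow> complex) \<Rightarrow> complex mat" where
  "form_mat n \<psi> a = Matrix.mat n n (\<lambda>(i, j). a (\<psi> j) (\<psi> i))"

definition mass_mat :: "'a::euclidean_space set \<Rightarrow> nat \<Rightarrow> (nat \<Rightarrow> 'a \<Rightarrow> complex) \<Rightarrow> complex mat" where
  "mass_mat \<Omega> n \<psi> = form_mat n \<psi> (l2_inner \<Omega>)"

definition stiff_mat :: "'a::euclidean_space set \<Rightarrow> nat \<Rightarrow> (nat \<Rightarrow> 'a \<Rightarrow> complex) \<Rightarrow> complex mat" where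
  "stiff_mat \<Omega> n \<psi> = form_mat n \<psi> (grad_inner \<Omega>)"

definition stiff_gamma_mat ::
  "real \<Rightarrow> 'a::euclidean_space set \<Rightarrow> 'a set \<Rightarrow> nat \<Rightarrow> (nat \<Rightarrow> 'a \<Rightarrow> complex) \<Rightarrow> complex mat" where
  "stiff_gamma_mat \<gamma> \<Omega> \<Gamma> n \<psi> = form_mat n \<psi> (grad_inner_gamma \<gamma> \<Omega> \<Gamma>)"

definition H_T ::
  "real \<Rightarrow> 'a::euclidean_space set \<Rightarrow> nat \<Rightarrow> (nat \<Rightarrow> 'a \<Rightarrow> complex) \<Rightarrow> complex mat" where
  "H_T \<M> \<Omega> n \<psi> = complex_of_real \<M> \<cdot>\<^sub>m stiff_mat \<Omega> n \<psi> - \<i> \<cdot>\<^sub>m mass_mat \<Omega> n \<psi>"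

definition H_P ::
  "real \<Rightarrow> real \<Rightarrow> real \<Rightarrow> 'a::euclidean_space set \<Rightarrow> 'a set \<Rightarrow> nat \<Rightarrow> (nat \<Rightarrow> 'a \<Rightarrow> complex) \<Rightarrow> complex mat"
  where
  "H_P \<gamma> \<M> \<Lambda> \<Omega> \<Gamma> n \<psi> =
     (1 - \<i> * complex_of_real (\<gamma> * \<Lambda>)) \<cdot>\<^sub>m stiff_gamma_mat \<gamma> \<Omega> \<Gamma> n \<psi>
       - complex_of_real (\<gamma> * (1 - \<Lambda> / \<M>) - \<Lambda> / \<M>) \<cdot>\<^sub>m mass_mat \<Omega> n \<psi>"

definition M_1 :: "real \<Rightarrow> 'a::euclidean_space set \<Rightarrow> nat \<Rightarrow> (nat \<Rightarrow> 'a \<Rightarrow> complex) \<Rightarrow> complex mat" where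
  "M_1 \<gamma> \<Omega> n \<psi> = (\<i> * complex_of_real ((\<gamma> - 1) / \<gamma>)) \<cdot>\<^sub>m mass_mat \<Omega> n \<psi>"

definition M_2 ::
  "real \<Rightarrow> real \<Rightarrow> real \<Rightarrow> 'a::euclidean_space set \<Rightarrow> nat \<Rightarrow> (nat \<Rightarrow> 'a \<Rightarrow> complex) \<Rightarrow> complex mat" where
  "M_2 \<gamma> \<M> \<Lambda> \<Omega> n \<psi> = complex_of_real (\<gamma> * (1 - \<Lambda> / \<M>)) \<cdot>\<^sub>m mass_mat \<Omega> n \<psi>"


section \<open>The surface measure is the Hausdorff measure\<close>

text \<open>
  \<^const>\<open>measure_of\<close> yields the zero measure when it is given a set function that is not a measure.
  The following shows that this does not happen for \<^const>\<open>surface_measure\<close>: the Hausdorff outer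
  measure is a metric outer measure, hence a measure on the Borel sets.
\<close>

lemma hausdorff_pre_empty:
  assumes "0 < m" "0 < \<delta>" shows "hausdorff_pre m \<delta> ({} :: 'a::metric_space set) = 0"
proof -
  have "hausdorff_pre m \<delta> ({} :: 'a set)
      \<le> (\<Sum>i::nat. ennreal (unit_ball_vol (real m) / 2 ^ m * diameter ({}::'a set) ^ m))"
    unfolding hausdorff_pre_def
    by (rule INF_lower2[of "\<lambda>_. {}"]) (use assms in auto)
  then show ?thesis using assms by (simp add: zero_power)
qed

lemma hausdorff_pre_mono: "A \<subseteq> B \<Longrightarrow> hausdorff_pre m \<delta> A \<le> hausdorff_pre m \<delta> B"
  unfolding hausdorff_pre_def by (rule INF_superset_mono) auto

lemma hausdorff_pre_antimono: "\<delta> \<le> \<delta>' \<Longrightarrow> hausdorff_pre m \<delta>' A \<le> hausdorff_pre m \<delta> A"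
  unfolding hausdorff_pre_def by (rule INF_superset_mono) (auto intro: order_trans)

lemma hausdorff_pre_UN:
  fixes A :: "nat \<Rightarrow> 'a::metric_space set"
  shows "hausdorff_pre m \<delta> (\<Union>n. A n) \<le> (\<Sum>n. hausdorff_pre m \<delta> (A n))"
proof (rule ennreal_le_epsilon)
  fix e :: real assume e: "0 < e" and fin: "(\<Sum>n. hausdorff_pre m \<delta> (A n)) < Orderings.top"
  define w where "w B = ennreal (unit_ball_vol (real m) / 2 ^ m * diameter (B :: 'a set) ^ m)" for B
  have "\<exists>U. A n \<subseteq> (\<Union>i. U i) \<and> (\<forall>i::nat. bounded (U i) \<and> diameter (U i) \<le> \<delta>) \<and>
            (\<Sum>i. w (U i)) \<le> hausdorff_pre m \<delta> (A n) + ennreal (e * (1/2) ^ Suc n)" for n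
  proof -
    have "hausdorff_pre m \<delta> (A n) < Orderings.top"
      using fin ennreal_suminf_lessD by blast
    then have "hausdorff_pre m \<delta> (A n) < hausdorff_pre m \<delta> (A n) + ennreal (e * (1/2) ^ Suc n)"
    proof -
      have "0 < ennreal (e * (1/2) ^ Suc n)" using e by (simp only: ennreal_less_zero_iff) simp
      then have "hausdorff_pre m \<delta> (A n) + 0 < hausdorff_pre m \<delta> (A n) + ennreal (e * (1/2) ^ Suc n)"
        using \<open>hausdorff_pre m \<delta> (A n) < Orderings.top\<close>
        by (simp only: ennreal_add_left_cancel_less) simp
      then show ?thesis by simp
    qed
    then show ?thesis
      unfolding hausdorff_pre_def INF_less_iff w_def by (blast intro: less_imp_le)
  qed
  then obtain U where U: "\<And>n. A n \<subseteq> (\<Union>i. U n i)"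
     "\<And>n i::nat. bounded (U n i) \<and> diameter (U n i) \<le> \<delta>"
     "\<And>n. (\<Sum>i. w (U n i)) \<le> hausdorff_pre m \<delta> (A n) + ennreal (e * (1/2) ^ Suc n)"
    by metis
  define W where "W p = (case prod_decode p of (n, i) \<Rightarrow> U n i)" for p
  have "hausdorff_pre m \<delta> (\<Union>n. A n) \<le> (\<Sum>p. w (W p))"
    unfolding hausdorff_pre_def w_def
  proof (rule INF_lower, clarify, intro conjI subsetI allI)
    fix x assume "x \<in> (\<Union>n. A n)"
    then obtain n i where "x \<in> U n i" using U(1) by blast
    then have "x \<in> W (prod_encode (n, i))" by (simp add: W_def)
    then show "x \<in> (\<Union>p. W p)" by blast
  qed (auto simp: W_def U split: prod.split)
  also have "\<dots> = (\<Sum>n. \<Sum>i. w (U n i))"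
  proof -
    have "(\<Sum>p. (\<lambda>(n, i). w (U n i)) (prod_decode p)) = (\<Sum>n. \<Sum>i. w (U n i))"
      using suminf_ennreal_2dimen[of "\<lambda>n. \<Sum>i. w (U n i)" "\<lambda>(n, i). w (U n i)"] by (simp add: comp_def)
    moreover have "w (W p) = (\<lambda>(n, i). w (U n i)) (prod_decode p)" for p
      by (simp add: W_def split: prod.split)
    ultimately show ?thesis by simp
  qed
  also have "\<dots> \<le> (\<Sum>n. hausdorff_pre m \<delta> (A n) + ennreal (e * (1/2) ^ Suc n))"
    by (intro suminf_le U(3)) auto
  also have "\<dots> = (\<Sum>n. hausdorff_pre m \<delta> (A n)) + (\<Sum>n. ennreal (e * (1/2) ^ Suc n))"
    by (rule suminf_add[symmetric]) auto
  also have "(\<Sum>n. ennreal (e * (1/2) ^ Suc n)) = ennreal e"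
    using sums_mult[OF power_half_series, of e] e by (intro suminf_ennreal_eq) auto
  finally show "hausdorff_pre m \<delta> (\<Union>n. A n) \<le> (\<Sum>n. hausdorff_pre m \<delta> (A n)) + ennreal e" .
qed

lemma hausdorff_outer_empty: "0 < m \<Longrightarrow> hausdorff_outer m {} = 0"
  unfolding hausdorff_outer_def by (simp add: hausdorff_pre_empty)

lemma hausdorff_outer_mono: "A \<subseteq> B \<Longrightarrow> hausdorff_outer m A \<le> hausdorff_outer m B"
  unfolding hausdorff_outer_def by (intro SUP_mono) (auto intro: hausdorff_pre_mono)

lemma hausdorff_pre_le_outer: "0 < \<delta> \<Longrightarrow> hausdorff_pre m \<delta> A \<le> hausdorff_outer m A"
  unfolding hausdorff_outer_def by (rule SUP_upper) auto

lemma hausdorff_outer_UN: "hausdorff_outer m (\<Union>n. A n) \<le> (\<Sum>n::nat. hausdorff_outer m (A n))"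
proof -
  have "hausdorff_pre m \<delta> (\<Union>n. A n) \<le> (\<Sum>n. hausdorff_outer m (A n))" if "0 < \<delta>" for \<delta>
    by (rule order_trans[OF hausdorff_pre_UN suminf_le])
       (auto intro: hausdorff_pre_le_outer that)
  then show ?thesis unfolding hausdorff_outer_def[of m "\<Union>n. A n"] by (intro SUP_least) auto
qed

lemma hausdorff_outer_Un: 
  assumes "0 < m" shows "hausdorff_outer m (A \<union> B) \<le> hausdorff_outer m A + hausdorff_outer m B"
proof -
  have "hausdorff_outer m (\<Union>n::nat. (if n = 0 then A else if n = 1 then B else {})) 
     \<le> (\<Sum>n::nat. hausdorff_outer m (if n = 0 then A else if n = 1 then B else {}))"
    by (rule hausdorff_outer_UN)
  also have "\<dots> = (\<Sum>n\<in>{0,1::nat}. hausdorff_outer m (if n = 0 then A else if n = 1 then B else {}))"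
    by (rule suminf_finite) (auto simp: hausdorff_outer_empty assms)
  also have "(\<Union>n::nat. (if n = 0 then A else if n = 1 then B else {})) = A \<union> B"
    by (auto split: if_splits)
  finally show ?thesis by simp
qed

lemma hausdorff_outer_separated:
  fixes A B :: "'a::metric_space set"
  assumes m: "0 < m" and r: "0 < r" and sep: "\<And>x y. x \<in> A \<Longrightarrow> y \<in> B \<Longrightarrow> r \<le> dist x y"
  shows "hausdorff_outer m A + hausdorff_outer m B \<le> hausdorff_outer m (A \<union> B)"
proof -
  have small: "hausdorff_pre m \<delta> A + hausdorff_pre m \<delta> B \<le> hausdorff_pre m \<delta> (A \<union> B)"
    if \<delta>: "\<delta> < r" for \<delta>
    unfolding hausdorff_pre_def[of m \<delta> "A \<union> B"]
  proof (rule INF_greatest, clarify)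
    fix U :: "nat \<Rightarrow> 'a set"
    assume cov: "A \<union> B \<subseteq> (\<Union>i. U i)" and d: "\<forall>i. bounded (U i) \<and> diameter (U i) \<le> \<delta>"
    define w where "w S = ennreal (unit_ball_vol (real m) / 2 ^ m * diameter (S :: 'a set) ^ m)" for S
    have w0: "w {} = 0" using m by (simp add: w_def)
    define V where "V i = (if U i \<inter> A \<noteq> {} then U i else {})" for i
    define W where "W i = (if U i \<inter> A \<noteq> {} then {} else U i)" for i
    have \<delta>0: "0 \<le> \<delta>" using d diameter_ge_0 order_trans by blast
    have "hausdorff_pre m \<delta> A \<le> (\<Sum>i. w (V i))"
      unfolding hausdorff_pre_def w_def
    proof (rule INF_lower, clarify, intro conjI subsetI allI)
      fix x assume "x \<in> A"
      then show "x \<in> (\<Union>i. V i)" using cov unfolding V_def by fastforce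
    qed (use d \<delta>0 in \<open>auto simp: V_def\<close>)
    moreover have "hausdorff_pre m \<delta> B \<le> (\<Sum>i. w (W i))"
      unfolding hausdorff_pre_def w_def
    proof (rule INF_lower, clarify, intro conjI subsetI allI)
      fix y assume y: "y \<in> B"
      then obtain i where i: "y \<in> U i" using cov by blast
      have "U i \<inter> A = {}"
      proof (rule ccontr)
        assume "U i \<inter> A \<noteq> {}"
        then obtain x where "x \<in> U i" "x \<in> A" by blast
        then have "r \<le> dist x y" "dist x y \<le> \<delta>"
          using sep y i d diameter_bounded_bound[of "U i" x y] by (auto intro: order_trans)
        then show False using \<delta> by simp
      qed
      then show "y \<in> (\<Union>i. W i)" using i unfolding W_def by fastforce
    qed (use d \<delta>0 in \<open>auto simp: W_def\<close>)
    moreover have "(\<Sum>i. w (V i)) + (\<Sum>i. w (W i)) = (\<Sum>i. w (V i) + w (W i))"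
      by (rule suminf_add) auto
    moreover have "w (V i) + w (W i) = w (U i)" for i
      by (simp add: V_def W_def w0)
    ultimately have "hausdorff_pre m \<delta> A + hausdorff_pre m \<delta> B \<le> (\<Sum>i. w (U i))"
      by (metis (no_types, lifting) add_mono suminf_cong)
    then show "hausdorff_pre m \<delta> A + hausdorff_pre m \<delta> B
        \<le> (\<Sum>i. ennreal (unit_ball_vol (real m) / 2 ^ m * diameter (U i) ^ m))"
      by (simp add: w_def)
  qed
  have "hausdorff_outer m A + hausdorff_outer m B
      = (SUP \<delta>\<in>{0<..}. hausdorff_pre m \<delta> A + hausdorff_pre m \<delta> B)"
    unfolding hausdorff_outer_def
  proof (rule SUP_add_directed_ennreal[symmetric])
    fix i j :: real assume "i \<in> {0<..}" "j \<in> {0<..}"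
    then show "\<exists>k\<in>{0<..}. hausdorff_pre m i A + hausdorff_pre m j B \<le> hausdorff_pre m k A + hausdorff_pre m k B"
      by (intro bexI[of _ "min i j"] add_mono hausdorff_pre_antimono) auto
  qed
  also have "\<dots> \<le> hausdorff_outer m (A \<union> B)"
  proof (rule SUP_least)
    fix \<delta> :: real assume "\<delta> \<in> {0<..}"
    then have "hausdorff_pre m \<delta> A + hausdorff_pre m \<delta> B
      \<le> hausdorff_pre m (min \<delta> (r/2)) A + hausdorff_pre m (min \<delta> (r/2)) B"
      by (intro add_mono hausdorff_pre_antimono) auto
    also have "\<dots> \<le> hausdorff_pre m (min \<delta> (r/2)) (A \<union> B)" using r by (intro small) auto
    also have "\<dots> \<le> hausdorff_outer m (A \<union> B)"
      using r \<open>\<delta> \<in> {0<..}\<close> by (intro hausdorff_pre_le_outer) auto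
    finally show "hausdorff_pre m \<delta> A + hausdorff_pre m \<delta> B \<le> hausdorff_outer m (A \<union> B)" .
  qed
  finally show ?thesis .
qed

lemma hausdorff_outer_closed_split:
  fixes C X :: "'a::metric_space set"
  assumes m: "0 < m" and C: "closed C"
  shows "hausdorff_outer m (X \<inter> C) + hausdorff_outer m (X - C) \<le> hausdorff_outer m X"
proof (cases "C = {} \<or> hausdorff_outer m X = Orderings.top")
  case True then show ?thesis using m by (auto simp: hausdorff_outer_empty)
next
  case False
  then have Cne: "C \<noteq> {}" and fin: "hausdorff_outer m X \<noteq> Orderings.top" by auto
  define \<mu> where "\<mu> = (hausdorff_outer m :: 'a set \<Rightarrow> ennreal)"
  define f where "f x = infdist x C" for x
  have f_dist: "f x \<le> f y + dist x y" for x y unfolding f_def by (rule infdist_triangle)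
  define r where "r n = 1 / real (Suc n)" for n
  have rpos: "0 < r n" for n by (simp add: r_def)
  have rmono: "n \<le> k \<Longrightarrow> r k \<le> r n" for n k by (simp add: r_def frac_le)
  have rstrict: "r (Suc n) < r n" for n by (simp add: r_def divide_simps)
  define A where "A n = {x \<in> X. r n \<le> f x}" for n
  define R where "R k = {x \<in> X. r (Suc k) \<le> f x \<and> f x < r k}" for k
  have partial: "(\<Sum>j<N. \<mu> (R (2 * j + b))) \<le> \<mu> (\<Union>j<N. R (2 * j + b))" for N b
  proof (induction N)
    case 0 show ?case by simp
  next
    case (Suc N)
    have *: "\<mu> (\<Union>j<N. R (2 * j + b)) + \<mu> (R (2 * N + b)) \<le> \<mu> ((\<Union>j<N. R (2 * j + b)) \<union> R (2 * N + b))"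
    proof (cases "N = 0")
      case True then show ?thesis by (simp add: \<mu>_def hausdorff_outer_empty[OF m])
    next
      case False
      define k where "k = 2 * N + b - 1"
      have k: "2 * N + b = Suc k" using False by (simp add: k_def)
      show ?thesis unfolding \<mu>_def k
      proof (rule hausdorff_outer_separated[OF m, of "r k - r (Suc k)"])
        fix x y assume x: "x \<in> (\<Union>j<N. R (2 * j + b))" and y: "y \<in> R (Suc k)"
        then obtain j where j: "j < N" "r (Suc (2 * j + b)) \<le> f x" by (auto simp: R_def)
        then have "r k \<le> r (Suc (2 * j + b))" using k by (intro rmono) linarith
        moreover have "f y < r (Suc k)" using y by (auto simp: R_def)
        ultimately show "r k - r (Suc k) \<le> dist x y"
          using f_dist[of x y] j by linarith
      qed (use rstrict[of k] in simp)
    qed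
    have "(\<Sum>j<Suc N. \<mu> (R (2 * j + b))) \<le> \<mu> (\<Union>j<N. R (2 * j + b)) + \<mu> (R (2 * N + b))"
      using Suc by (simp add: add_right_mono)
    also note *
    also have "(\<Union>j<N. R (2 * j + b)) \<union> R (2 * N + b) = (\<Union>j<Suc N. R (2 * j + b))"
      by (auto simp: lessThan_Suc)
    finally show ?case .
  qed
  have bound: "(\<Sum>k<N. \<mu> (R k)) \<le> 2 * \<mu> X" for N
  proof -
    have RX: "(\<Union>j<N. R (2 * j + b)) \<subseteq> X" for b by (auto simp: R_def)
    have "(\<Sum>k<N. \<mu> (R k)) \<le> (\<Sum>k<2 * N. \<mu> (R k))" by (rule sum_mono2) auto
    also have "\<dots> = (\<Sum>j<N. \<mu> (R (2 * j))) + (\<Sum>j<N. \<mu> (R (2 * j + 1)))"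
      by (induction N) (simp_all add: algebra_simps)
    also have "\<dots> \<le> \<mu> X + \<mu> X"
      using order_trans[OF partial[of 0 N] hausdorff_outer_mono[OF RX[of 0], of m, folded \<mu>_def]]
            order_trans[OF partial[of 1 N] hausdorff_outer_mono[OF RX[of 1], of m, folded \<mu>_def]]
      by (intro add_mono) auto
    finally show ?thesis by (simp add: mult_2)
  qed
  define a where "a k = enn2real (\<mu> (R k))" for k
  have \<mu>R: "\<mu> (R k) = ennreal (a k)" for k
  proof -
    have "\<mu> (R k) \<le> \<mu> X" unfolding \<mu>_def by (rule hausdorff_outer_mono) (auto simp: R_def)
    then have "\<mu> (R k) \<noteq> Orderings.top" using fin unfolding \<mu>_def by (metis neq_top_trans)
    then show ?thesis unfolding a_def by (simp only: ennreal_enn2real_if if_False)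
  qed
  have a0: "0 \<le> a k" for k by (simp add: a_def)
  have sumR: "(\<Sum>k<N. a k) \<le> enn2real (2 * \<mu> X)" for N
  proof -
    have "ennreal (\<Sum>k<N. a k) = (\<Sum>k<N. \<mu> (R k))" by (simp add: \<mu>R a0 sum_ennreal)
    then have "ennreal (\<Sum>k<N. a k) \<le> 2 * \<mu> X" using bound by simp
    moreover have "2 * \<mu> X < Orderings.top"
      using fin unfolding \<mu>_def less_top[symmetric] ennreal_mult_eq_top_iff by simp
    ultimately show ?thesis by (metis a0 enn2real_ennreal enn2real_mono sum_nonneg)
  qed
  have sa: "summable a"
    by (rule summableI_nonneg_bounded[OF a0 sumR])
  have fX: "\<exists>n. r n \<le> f x" if "x \<notin> C" for x
  proof -
    have "0 < f x" using infdist_pos_not_in_closed[OF C Cne that] by (simp add: f_def)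
    then show ?thesis using nat_approx_posE[of "f x"] by (metis less_imp_le r_def)
  qed
  have main: "\<mu> (X \<inter> C) + \<mu> (X - C) \<le> \<mu> X + ennreal (\<Sum>k. a (k + n))" for n
  proof -
    have "X - C \<subseteq> A n \<union> (\<Union>k. R (k + n))"
    proof
      fix x assume x: "x \<in> X - C"
      define j where "j = (LEAST j. r j \<le> f x)"
      have j: "r j \<le> f x" unfolding j_def by (rule LeastI_ex) (use fX x in auto)
      show "x \<in> A n \<union> (\<Union>k. R (k + n))"
      proof (cases "j \<le> n")
        case True then show ?thesis using j rmono[of j n] x by (auto simp: A_def)
      next
        case False
        then obtain i where i: "j = Suc (i + n)" using less_imp_Suc_add[of n j] by (auto simp: add.commute)
        then have "\<not> r (i + n) \<le> f x" using not_less_Least[of "i + n" "\<lambda>j. r j \<le> f x"] by (simp add: j_def[symmetric])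
        then have "x \<in> R (i + n)" using j i x by (auto simp: R_def)
        then show ?thesis by blast
      qed
    qed
    then have "\<mu> (X - C) \<le> \<mu> (A n \<union> (\<Union>k. R (k + n)))" unfolding \<mu>_def by (rule hausdorff_outer_mono)
    also have "\<dots> \<le> \<mu> (A n) + \<mu> (\<Union>k. R (k + n))" unfolding \<mu>_def by (rule hausdorff_outer_Un[OF m])
    also have "\<mu> (\<Union>k. R (k + n)) \<le> (\<Sum>k. \<mu> (R (k + n)))" unfolding \<mu>_def by (rule hausdorff_outer_UN)
    also have "(\<Sum>k. \<mu> (R (k + n))) = ennreal (\<Sum>k. a (k + n))"
      unfolding \<mu>R using sa a0 by (intro suminf_ennreal2) (auto simp: summable_iff_shift)
    finally have "\<mu> (X \<inter> C) + \<mu> (X - C) \<le> (\<mu> (X \<inter> C) + \<mu> (A n)) + ennreal (\<Sum>k. a (k + n))"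
      by (simp add: add.assoc add_left_mono)
    also have "\<mu> (X \<inter> C) + \<mu> (A n) \<le> \<mu> (X \<inter> C \<union> A n)"
      unfolding \<mu>_def
    proof (rule hausdorff_outer_separated[OF m rpos[of n]])
      fix x y assume "x \<in> X \<inter> C" "y \<in> A n"
      then show "r n \<le> dist x y"
        using f_dist[of y x] by (auto simp: A_def f_def dist_commute)
    qed
    also have "\<mu> (X \<inter> C \<union> A n) \<le> \<mu> X" unfolding \<mu>_def by (rule hausdorff_outer_mono) (auto simp: A_def)
    finally show ?thesis by (simp add: add_right_mono)
  qed
  have "(\<lambda>n. \<mu> X + ennreal (\<Sum>k. a (k + n))) \<longlonglongrightarrow> \<mu> X + ennreal 0"
    by (intro tendsto_add tendsto_const tendsto_ennrealI suminf_exist_split2 sa)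
  then have "\<mu> (X \<inter> C) + \<mu> (X - C) \<le> \<mu> X + ennreal 0"
    by (rule Lim_bounded2) (use main in auto)
  then show ?thesis by (simp add: \<mu>_def)
qed

lemma measure_space_hausdorff:
  assumes m: "0 < m"
  shows "measure_space UNIV (sets borel) (hausdorff_outer m :: 'a::metric_space set \<Rightarrow> ennreal)"
proof -
  let ?\<mu> = "hausdorff_outer m :: 'a set \<Rightarrow> ennreal"
  define L where "L = lambda_system UNIV UNIV ?\<mu>"
  interpret P: sigma_algebra "UNIV :: 'a set" UNIV using sigma_algebra_Pow[of UNIV] by simp
  have "outer_measure_space UNIV ?\<mu>"
    unfolding outer_measure_space_def positive_def increasing_def countably_subadditive_def
    using hausdorff_outer_empty[OF m] hausdorff_outer_mono hausdorff_outer_UN by blast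
  then have L: "measure_space UNIV L ?\<mu>" unfolding L_def by (rule P.caratheodory_lemma)
  then have L': "sigma_algebra UNIV L" "positive L ?\<mu>" "countably_additive L ?\<mu>"
    unfolding measure_space_def by blast+
  have "C \<in> L" if "closed C" for C
  proof -
    have "?\<mu> (X \<inter> C) + ?\<mu> (X - C) = ?\<mu> X" for X
    proof (rule antisym)
      show "?\<mu> (X \<inter> C) + ?\<mu> (X - C) \<le> ?\<mu> X" by (rule hausdorff_outer_closed_split[OF m that])
      show "?\<mu> X \<le> ?\<mu> (X \<inter> C) + ?\<mu> (X - C)"
        using hausdorff_outer_Un[OF m, of "X \<inter> C" "X - C"] by (simp only: Int_Diff_Un)
    qed
    then show ?thesis unfolding L_def P.lambda_system_eq by blast
  qed
  then have "sigma_sets UNIV (Collect closed) \<subseteq> L"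
    by (intro sigma_algebra.sigma_sets_subset[OF L'(1)]) blast
  then have sub: "sets borel \<subseteq> L" by (simp add: borel_eq_closed)
  have "sigma_algebra UNIV (sets (borel :: 'a measure))"
    using sets.sigma_algebra_axioms[of "borel :: 'a measure"] by (simp only: space_borel)
  moreover have "positive (sets borel) ?\<mu>"
    using L'(2) unfolding positive_def by blast
  moreover have "countably_additive (sets borel) ?\<mu>"
    using L'(3) sub unfolding countably_additive_def by (meson order_trans subsetD)
  ultimately show ?thesis unfolding measure_space_def by blast
qed

lemma emeasure_surface_measure:
  assumes "2 \<le> DIM('a::euclidean_space)" and "A \<in> sets borel"
  shows "emeasure (surface_measure :: 'a measure) A = hausdorff_outer (DIM('a) - 1) A"
proof -
  have sp: "sets (borel :: 'a measure) \<subseteq> Pow UNIV" by blast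
  have S: "sets (surface_measure :: 'a measure) = sets borel"
    unfolding surface_measure_def sets_measure_of[OF sp]
    using sets.sigma_sets_eq[of "borel :: 'a measure"] by (simp only: space_borel)
  have "measure_space UNIV (sets borel) (hausdorff_outer (DIM('a) - 1) :: 'a set \<Rightarrow> ennreal)"
    using assms(1) by (intro measure_space_hausdorff) linarith
  then have "positive (sets (surface_measure :: 'a measure)) (hausdorff_outer (DIM('a) - 1))"
    "countably_additive (sets (surface_measure :: 'a measure)) (hausdorff_outer (DIM('a) - 1))"
    unfolding measure_space_def S by blast+
  moreover have "A \<in> sets (surface_measure :: 'a measure)" using assms(2) by (simp only: S)
  ultimately show ?thesis by (rule emeasure_measure_of[OF surface_measure_def sp])
qed

end

theory Submission
  imports Defs
begin

text \<open>
  Let \<open>u\<close>, \<open>w\<close> be the finite element functions with coefficient vectors \<open>T\<close>, \<open>P\<close>. With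
  \<open>\<delta> = \<mu> - 1\<close> the two block rows read \<open>\<delta> A\<^sub>T u = m\<^sub>1 (w, \<cdot>)\<close> and \<open>\<delta> A\<^sub>P w = m\<^sub>2 (u, \<cdot>)\<close>, where
  \<open>m\<^sub>1 = \<i> (\<gamma> - 1) / \<gamma>\<close> and \<open>m\<^sub>2 = \<gamma> (1 - \<Lambda> / \<M>)\<close>. The dual norm of \<open>(w, \<cdot>)\<close> is at most the \<open>L\<^sup>2\<close> norm of \<open>w\<close>, so
  \<open>|\<delta>| \<parallel>u\<parallel> \<le> C\<^sub>T |m\<^sub>1| \<parallel>w\<parallel>\<close> and \<open>|\<delta>| \<parallel>w\<parallel> \<le> C\<^sub>P |m\<^sub>2| \<parallel>u\<parallel>\<close>. If \<open>\<delta> \<noteq> 0\<close>, neither \<open>u\<close> nor \<open>w\<close>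
  vanishes, and multiplying the two bounds gives \<open>|\<delta>|\<^sup>2 \<le> C\<^sub>T C\<^sub>P |m\<^sub>1 m\<^sub>2|\<close>.
\<close>

section \<open>Sesquilinear forms on spaces of complex functions\<close>

text \<open>The closure conditions of \<open>antidual\<close> without extensionality, so that they
  apply to \<open>a u\<close> itself and not only to its restriction to \<open>V\<close>.\<close>

definition antilinear_on :: "('a \<Rightarrow> complex) set \<Rightarrow> (('a \<Rightarrow> complex) \<Rightarrow> complex) \<Rightarrow> bool" where
  "antilinear_on V F \<longleftrightarrow>
     (\<forall>u\<in>V. \<forall>v\<in>V. F (\<lambda>x. u x + v x) = F u + F v) \<and>
     (\<forall>c. \<forall>v\<in>V. F (\<lambda>x. c * v x) = cnj c * F v)"

text \<open>Linearity in the first argument is encoded as antilinearity of the conjugate, so that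
  each fact about \<open>antilinear_on\<close> serves both arguments.\<close>

definition sesquilinear_on ::
  "('a \<Rightarrow> complex) set \<Rightarrow> (('a \<Rightarrow> complex) \<Rightarrow> ('a \<Rightarrow> complex) \<Rightarrow> complex) \<Rightarrow> bool" where
  "sesquilinear_on V a \<longleftrightarrow>
     (\<forall>u\<in>V. antilinear_on V (a u)) \<and> (\<forall>v\<in>V. antilinear_on V (\<lambda>u. cnj (a u v)))"

lemma antilinear_on_lincomb:
  assumes "antilinear_on V F" "antilinear_on V G"
  shows "antilinear_on V (\<lambda>v. c * F v + d * G v)"
  using assms unfolding antilinear_on_def by (auto simp: algebra_simps)

lemma sesquilinear_on_lincomb:
  assumes "sesquilinear_on V a" "sesquilinear_on V b"
  shows "sesquilinear_on V (\<lambda>u v. c * a u v + d * b u v)"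
proof -
  have "antilinear_on V (\<lambda>u. cnj (c * a u v + d * b u v))" if "v \<in> V" for v
    using antilinear_on_lincomb[of V "\<lambda>u. cnj (a u v)" "\<lambda>u. cnj (b u v)" "cnj c" "cnj d"] assms that
    by (simp add: sesquilinear_on_def)
  then show ?thesis
    using assms by (simp add: sesquilinear_on_def antilinear_on_lincomb)
qed

lemma sesquilinear_on_hermitian:
  assumes "\<And>u v. cnj (a u v) = a v u" "\<And>u. u \<in> V \<Longrightarrow> antilinear_on V (a u)"
  shows "sesquilinear_on V a"
  using assms by (simp add: sesquilinear_on_def)

lemma sesquilinear_on_simps:
  assumes "sesquilinear_on V a" "u \<in> V" "v \<in> V" "w \<in> V"
  shows "a (\<lambda>x. u x + v x) w = a u w + a v w" "a w (\<lambda>x. u x + v x) = a w u + a w v"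
    "a (\<lambda>x. c * u x) w = c * a u w" "a w (\<lambda>x. c * u x) = cnj c * a w u"
proof -
  have A: "antilinear_on V (a w)" "antilinear_on V (\<lambda>u. cnj (a u w))"
    using assms by (auto simp: sesquilinear_on_def)
  show "a w (\<lambda>x. u x + v x) = a w u + a w v" "a w (\<lambda>x. c * u x) = cnj c * a w u"
    using A(1) assms(2,3) by (auto simp: antilinear_on_def)
  have "cnj (a (\<lambda>x. u x + v x) w) = cnj (a u w + a v w)" "cnj (a (\<lambda>x. c * u x) w) = cnj (c * a u w)"
    using A(2) assms(2,3) by (auto simp: antilinear_on_def)
  then show "a (\<lambda>x. u x + v x) w = a u w + a v w" "a (\<lambda>x. c * u x) w = c * a u w"
    by (simp_all only: complex_cnj_cancel_iff)
qed

text \<open>Since \<open>V\<close> is closed under sums and multiples, restricting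
  \<open>a u\<close> to \<open>V\<close> changes no value in the antilinearity equations.\<close>

lemma assoc_op_in_antidual_iff: "assoc_op V a u \<in> antidual V \<longleftrightarrow> antilinear_on V (a u)"
  if "\<And>u v. u \<in> V \<Longrightarrow> v \<in> V \<Longrightarrow> (\<lambda>x. u x + v x) \<in> V" "\<And>c u. u \<in> V \<Longrightarrow> (\<lambda>x. c * u x) \<in> V"
  using that by (simp add: assoc_op_def antidual_def antilinear_on_def)

section \<open>Linear combinations in a function space and matrices of forms\<close>

locale function_space =
  fixes V :: "('a \<Rightarrow> complex) set"
  assumes zero_mem: "(\<lambda>_. 0) \<in> V"
    and add_mem: "u \<in> V \<Longrightarrow> v \<in> V \<Longrightarrow> (\<lambda>x. u x + v x) \<in> V"
    and scale_mem: "u \<in> V \<Longrightarrow> (\<lambda>x. c * u x) \<in> V"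
begin

lemma sum_mem: "(\<And>i. i < n \<Longrightarrow> f i \<in> V) \<Longrightarrow> (\<lambda>x. \<Sum>i<n. c i * f i x) \<in> V" for n :: nat
  by (induction n) (auto simp: zero_mem add_mem scale_mem)

lemma antilinear_on_sum:
  fixes n :: nat
  assumes F: "antilinear_on V F"
  shows "(\<And>i. i < n \<Longrightarrow> f i \<in> V) \<Longrightarrow> F (\<lambda>x. \<Sum>i<n. c i * f i x) = (\<Sum>i<n. cnj (c i) * F (f i))"
proof (induction n)
  case 0
  \<comment> \<open>The empty sum is the zero function, and homogeneity with factor 0 gives it the
    value 0.\<close>
  have "\<forall>v\<in>V. F (\<lambda>x. 0 * v x) = cnj 0 * F v"
    using F unfolding antilinear_on_def by blast
  from bspec[OF this zero_mem] show ?case by simp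
next
  case (Suc n)
  have "F (\<lambda>x. (\<Sum>i<n. c i * f i x) + c n * f n x)
      = F (\<lambda>x. \<Sum>i<n. c i * f i x) + F (\<lambda>x. c n * f n x)"
  proof -
    have "(\<lambda>x. \<Sum>i<n. c i * f i x) \<in> V" "(\<lambda>x. c n * f n x) \<in> V"
      using Suc.prems by (auto intro!: sum_mem scale_mem)
    then show ?thesis using F by (simp add: antilinear_on_def)
  qed
  also have "F (\<lambda>x. c n * f n x) = cnj (c n) * F (f n)"
    using F Suc.prems by (auto simp: antilinear_on_def)
  finally show ?case using Suc by simp
qed

lemma sesquilinear_on_sum:
  fixes n :: nat
  assumes a: "sesquilinear_on V a" and f: "\<And>i. i < n \<Longrightarrow> f i \<in> V" and w: "w \<in> V"
  shows "a (\<lambda>x. \<Sum>i<n. c i * f i x) w = (\<Sum>i<n. c i * a (f i) w)"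
    and "a w (\<lambda>x. \<Sum>i<n. c i * f i x) = (\<Sum>i<n. cnj (c i) * a w (f i))"
proof -
  show "a w (\<lambda>x. \<Sum>i<n. c i * f i x) = (\<Sum>i<n. cnj (c i) * a w (f i))"
    using a w by (intro antilinear_on_sum f) (auto simp: sesquilinear_on_def)
  have "cnj (a (\<lambda>x. \<Sum>i<n. c i * f i x) w) = (\<Sum>i<n. cnj (c i) * cnj (a (f i) w))"
    using a w by (intro antilinear_on_sum[of "\<lambda>u. cnj (a u w)"] f) (auto simp: sesquilinear_on_def)
  also have "\<dots> = cnj (\<Sum>i<n. c i * a (f i) w)" by simp
  finally show "a (\<lambda>x. \<Sum>i<n. c i * f i x) w = (\<Sum>i<n. c i * a (f i) w)"
    by (simp only: complex_cnj_cancel_iff)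
qed

lemma sesquilinear_on_zero:
  assumes "sesquilinear_on V a" "v \<in> V"
  shows "a (\<lambda>_. 0) v = 0"
  using sesquilinear_on_simps(3)[OF assms(1) zero_mem zero_mem assms(2), of 0] by simp

lemma antilinear_on_of_bij:
  assumes "bij_betw (assoc_op V a) V (antidual V)" "u \<in> V"
  shows "antilinear_on V (a u)"
proof -
  have "assoc_op V a u \<in> antidual V" using assms by (auto simp: bij_betw_def)
  then show ?thesis by (simp add: assoc_op_in_antidual_iff add_mem scale_mem)
qed

text \<open>In \<open>form_mat\<close> the column index goes into the linear slot and the row index
  into the antilinear one, so a row of the product is the form of the assembled function tested with
  one basis function.\<close>

lemma form_mat_mult_vec:
  fixes X :: "complex Matrix.vec"
  assumes "sesquilinear_on V a" "\<And>i. i < n \<Longrightarrow> \<psi> i \<in> V" "X \<in> carrier_vec n" "i < n"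
  shows "(form_mat n \<psi> a *\<^sub>v X) $ i = a (\<lambda>x. \<Sum>j<n. X $ j * \<psi> j x) (\<psi> i)"
proof -
  have "(form_mat n \<psi> a *\<^sub>v X) $ i = (\<Sum>j<n. X $ j * a (\<psi> j) (\<psi> i))"
    using assms(3,4) by (auto simp: form_mat_def scalar_prod_def atLeast0LessThan mult.commute intro!: sum.cong)
  then show ?thesis using assms by (simp add: sesquilinear_on_sum)
qed

end


section \<open>The \<open>L\<^sup>2\<close> inner product on continuous functions\<close>

text \<open>Conjugation commutes with the Bochner integral for every integrand; if the integrand is
  not integrable, both integrals are 0 by convention.\<close>

lemma cnj_l2_inner: "cnj (l2_inner \<Omega> f g) = l2_inner \<Omega> g f"
  unfolding l2_inner_def set_lebesgue_integral_def
  by (simp add: mult.commute flip: Bochner_Integration.integral_cnj)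

lemma cnj_grad_inner: "cnj (grad_inner \<Omega> f g) = grad_inner \<Omega> g f"
  unfolding grad_inner_def set_lebesgue_integral_def
  by (simp add: mult.commute flip: Bochner_Integration.integral_cnj)

lemma cnj_bdry_inner: "cnj (bdry_inner \<Gamma> f g) = bdry_inner \<Gamma> g f"
  unfolding bdry_inner_def set_lebesgue_integral_def
  by (simp add: mult.commute flip: Bochner_Integration.integral_cnj)

text \<open>Continuity on the compact closure yields integrability of products; together with
  vanishing outside the closure it makes the L2 norm definite on \<open>V\<close>.\<close>

locale continuous_function_space = function_space V
  for V :: "('a::euclidean_space \<Rightarrow> complex) set" +
  fixes \<Omega> :: "'a set"
  assumes open_dom: "open \<Omega>" and bounded_dom: "bounded \<Omega>"
    and cont: "u \<in> V \<Longrightarrow> continuous_on (closure \<Omega>) u"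
    and zero_outside: "u \<in> V \<Longrightarrow> x \<notin> closure \<Omega> \<Longrightarrow> u x = 0"
begin

lemma set_integrable_mult_cnj:
  assumes "u \<in> V" "v \<in> V"
  shows "set_integrable lebesgue \<Omega> (\<lambda>x. u x * cnj (v x))"
proof -
  have "continuous_on (closure \<Omega>) (\<lambda>x. u x * cnj (v x))"
    using assms by (intro continuous_intros cont)
  then have I: "integrable lborel (\<lambda>x. indicator (closure \<Omega>) x *\<^sub>R (u x * cnj (v x)))"
    using bounded_dom by (intro borel_integrable_compact) (simp_all add: compact_closure)
  then have "set_integrable lebesgue (closure \<Omega>) (\<lambda>x. u x * cnj (v x))"
    unfolding set_integrable_def
    using integrable_completion[OF borel_measurable_integrable[OF I]] by blast
  then show ?thesis
    by (rule set_integrable_subset) (use open_dom closure_subset in auto)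
qed

lemma sesquilinear_l2_inner: "sesquilinear_on V (l2_inner \<Omega>)"
proof (rule sesquilinear_on_hermitian[OF cnj_l2_inner])
  fix u assume u: "u \<in> V"
  have "l2_inner \<Omega> u (\<lambda>x. v x + w x) = l2_inner \<Omega> u v + l2_inner \<Omega> u w" if "v \<in> V" "w \<in> V" for v w
    using set_integral_add(2)[OF set_integrable_mult_cnj set_integrable_mult_cnj, of u v u w] u that
    by (simp add: l2_inner_def distrib_left)
  moreover have "l2_inner \<Omega> u (\<lambda>x. c * v x) = cnj c * l2_inner \<Omega> u v" for c v
    using set_integral_mult_right[of lebesgue \<Omega> "cnj c" "\<lambda>x. u x * cnj (v x)"]
    by (simp add: l2_inner_def mult.left_commute)
  ultimately show "antilinear_on V (l2_inner \<Omega> u)" by (simp add: antilinear_on_def)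
qed

lemma Re_l2_inner_self:
  assumes "u \<in> V"
  shows "Re (l2_inner \<Omega> u u) = integral\<^sup>L lebesgue (\<lambda>x. indicator \<Omega> x * (cmod (u x))\<^sup>2)"
    and "integrable lebesgue (\<lambda>x. indicator \<Omega> x * (cmod (u x))\<^sup>2)"
proof -
  have I: "integrable lebesgue (\<lambda>x. indicator \<Omega> x *\<^sub>R (u x * cnj (u x)))"
    using set_integrable_mult_cnj[OF assms assms] by (simp add: set_integrable_def)
  have eq: "Re (indicator \<Omega> x *\<^sub>R (u x * cnj (u x))) = indicator \<Omega> x * (cmod (u x))\<^sup>2" for x
    by (simp del: of_real_power flip: complex_norm_square)
  show "Re (l2_inner \<Omega> u u) = integral\<^sup>L lebesgue (\<lambda>x. indicator \<Omega> x * (cmod (u x))\<^sup>2)"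
    unfolding l2_inner_def set_lebesgue_integral_def integral_Re[OF I, symmetric] eq ..
  show "integrable lebesgue (\<lambda>x. indicator \<Omega> x * (cmod (u x))\<^sup>2)"
    using integrable_Re[OF I] unfolding eq .
qed

lemma Re_l2_inner_self_nonneg: "u \<in> V \<Longrightarrow> 0 \<le> Re (l2_inner \<Omega> u u)"
  unfolding Re_l2_inner_self(1) by (rule Bochner_Integration.integral_nonneg) simp

lemma l2_norm_nonneg: "u \<in> V \<Longrightarrow> 0 \<le> l2_norm \<Omega> u"
  by (simp add: l2_norm_def Re_l2_inner_self_nonneg)

text \<open>By Hermitian symmetry the value equals its own conjugate and is therefore real.\<close>

lemma l2_inner_self: "u \<in> V \<Longrightarrow> l2_inner \<Omega> u u = complex_of_real ((l2_norm \<Omega> u)\<^sup>2)"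
  using arg_cong[OF cnj_l2_inner[of \<Omega> u u], of Im]
  by (simp add: l2_norm_def Re_l2_inner_self_nonneg complex_eq_iff)

text \<open>The set of points of \<Omega> where \<open>u\<close> does not vanish is open and null,
  hence empty. Continuity carries the value 0 to the closure, and outside it \<open>u\<close> is 0
  by membership in \<open>V\<close>.\<close>

lemma l2_norm_eq_0_imp:
  assumes u: "u \<in> V" and "l2_norm \<Omega> u = 0"
  shows "u = (\<lambda>_. 0)"
proof -
  have "Re (l2_inner \<Omega> u u) = 0" using assms by (simp add: l2_norm_def)
  then have "AE x in lebesgue. indicator \<Omega> x * (cmod (u x))\<^sup>2 = 0"
    unfolding Re_l2_inner_self(1)[OF u]
    by (subst (asm) integral_nonneg_eq_0_iff_AE[OF Re_l2_inner_self(2)[OF u]]) auto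
  then have ae: "AE x in lebesgue. x \<notin> {x \<in> \<Omega>. u x \<noteq> 0}"
    by eventually_elim (auto simp: indicator_def split: if_splits)
  have "continuous_on \<Omega> u" using cont[OF u] closure_subset continuous_on_subset by blast
  then have op: "open (\<Omega> \<inter> u -` (- {0}))"
    using open_dom by (intro continuous_open_preimage) auto
  have "\<Omega> \<inter> u -` (- {0}) = {x \<in> \<Omega>. u x \<noteq> 0}" by auto
  with op ae have "negligible (\<Omega> \<inter> u -` (- {0}))"
    by (simp add: negligible_iff_null_sets AE_iff_null_sets)
  with op have "\<Omega> \<inter> u -` (- {0}) = {}" using open_not_negligible by blast
  then have "u x = 0" if "x \<in> \<Omega>" for x using that by auto
  then have "u x = 0" if "x \<in> closure \<Omega>" for x
    using continuous_constant_on_closure[OF cont[OF u] _ that] by blast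
  then show ?thesis using zero_outside[OF u] by blast
qed

lemma l2_norm_pos: "u \<in> V \<Longrightarrow> u \<noteq> (\<lambda>_. 0) \<Longrightarrow> 0 < l2_norm \<Omega> u"
  using l2_norm_nonneg l2_norm_eq_0_imp by (metis order_le_less)

lemma l2_norm_zero: "l2_norm \<Omega> (\<lambda>_. 0) = 0"
  by (simp add: l2_norm_def l2_inner_def)

lemma l2_norm_scale: "u \<in> V \<Longrightarrow> l2_norm \<Omega> (\<lambda>x. c * u x) = cmod c * l2_norm \<Omega> u"
proof -
  assume u: "u \<in> V"
  have "l2_inner \<Omega> (\<lambda>x. c * u x) (\<lambda>x. c * u x) = (c * cnj c) * l2_inner \<Omega> u u"
    using u by (simp add: sesquilinear_on_simps[OF sesquilinear_l2_inner] scale_mem)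
  then have "Re (l2_inner \<Omega> (\<lambda>x. c * u x) (\<lambda>x. c * u x)) = (cmod c)\<^sup>2 * Re (l2_inner \<Omega> u u)"
    by (simp del: of_real_power flip: complex_norm_square)
  then show ?thesis by (simp add: l2_norm_def real_sqrt_mult)
qed

lemma l2_Cauchy_Schwarz:
  assumes u: "u \<in> V" and v: "v \<in> V"
  shows "cmod (l2_inner \<Omega> u v) \<le> l2_norm \<Omega> u * l2_norm \<Omega> v"
proof (cases "v = (\<lambda>_. 0)")
  case True
  then show ?thesis by (simp add: l2_inner_def l2_norm_zero)
next
  case False
  define s where "s = l2_norm \<Omega> v"
  define z where "z = l2_inner \<Omega> u v"
  \<comment> \<open>With this factor \<open>u + c v\<close> is the component of \<open>u\<close>
    orthogonal to \<open>v\<close>; its squared norm is nonnegative, which is the claim.\<close>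
  define c where "c = - z / s\<^sup>2"
  have s: "0 < s" using l2_norm_pos[OF v False] by (simp add: s_def)
  note simps = sesquilinear_on_simps[OF sesquilinear_l2_inner]
  have cv: "(\<lambda>x. c * v x) \<in> V" using v by (rule scale_mem)
  have w: "(\<lambda>x. u x + c * v x) \<in> V" using u cv by (rule add_mem)
  have "l2_inner \<Omega> (\<lambda>x. u x + c * v x) (\<lambda>x. u x + c * v x)
      = (l2_norm \<Omega> u)\<^sup>2 + cnj c * z + c * cnj z + c * cnj c * s\<^sup>2"
    using u v cv w by (simp add: simps l2_inner_self cnj_l2_inner z_def s_def algebra_simps)
  also have "\<dots> = (l2_norm \<Omega> u)\<^sup>2 - z * cnj z / s\<^sup>2"
    using s by (simp add: c_def field_simps power2_eq_square)
  also have "\<dots> = complex_of_real ((l2_norm \<Omega> u)\<^sup>2 - (cmod z)\<^sup>2 / s\<^sup>2)"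
    by (simp del: of_real_power flip: complex_norm_square)
  finally have "0 \<le> (l2_norm \<Omega> u)\<^sup>2 - (cmod z)\<^sup>2 / s\<^sup>2"
    using Re_l2_inner_self_nonneg[OF w] by simp
  then have "(cmod z)\<^sup>2 \<le> (l2_norm \<Omega> u * s)\<^sup>2"
    using s by (simp add: field_simps power_mult_distrib)
  then show ?thesis
    unfolding z_def s_def by (rule power2_le_imp_le) (simp add: l2_norm_nonneg u v)
qed

section \<open>Bounds from the norm of the inverse operator\<close>

text \<open>
  The nonzero functional \<open>(w, \<cdot>)\<close> has finite dual norm and a nonzero preimage, which rules out
  \<open>C \<le> 0\<close>.
\<close>

lemma dual_op_norm_bound:
  assumes a: "sesquilinear_on V a"
    and bij: "bij_betw (assoc_op V a) V (antidual V)"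
    and C: "dual_op_norm \<Omega> V (the_inv_into V (assoc_op V a)) \<le> ennreal C"
    and w: "w \<in> V" "w \<noteq> (\<lambda>_. 0)" and u: "u \<in> V"
    and eq: "\<And>v. v \<in> V \<Longrightarrow> a u v = l2_inner \<Omega> w v"
  shows "0 < C" and "l2_norm \<Omega> u \<le> C * l2_norm \<Omega> w"
proof -
  let ?F = "assoc_op V a u"
  \<comment> \<open>Testing with \<open>w\<close> gives its squared norm, so the functional is
    nonzero and takes part in the supremum defining the operator norm.\<close>
  have ww: "a u w \<noteq> 0"
    using eq[OF w(1)] l2_norm_pos[OF w] w(1) by (simp add: l2_inner_self)
  have u0: "0 < l2_norm \<Omega> u"
    using l2_norm_pos[OF u] ww sesquilinear_on_zero[OF a w(1)] by auto
  have "?F w \<noteq> 0" using ww w(1) by (simp add: assoc_op_def)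
  then have "?F \<in> antidual V - {\<lambda>v\<in>V. 0}"
    using bij u w(1) by (auto simp: bij_betw_def)
  then have "ennreal (l2_norm \<Omega> (the_inv_into V (assoc_op V a) ?F)) / dual_norm \<Omega> V ?F
      \<le> dual_op_norm \<Omega> V (the_inv_into V (assoc_op V a))"
    unfolding dual_op_norm_def by (rule SUP_upper)
  also have "the_inv_into V (assoc_op V a) ?F = u"
    using bij u by (intro the_inv_into_f_f) (auto simp: bij_betw_def)
  finally have *: "ennreal (l2_norm \<Omega> u) / dual_norm \<Omega> V ?F \<le> ennreal C"
    using C by order
  have "dual_norm \<Omega> V ?F \<le> ennreal (l2_norm \<Omega> w)"
    unfolding dual_norm_def
  proof (rule SUP_least)
    fix v assume v: "v \<in> V - {\<lambda>_. 0}"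
    then have "cmod (?F v) \<le> l2_norm \<Omega> w * l2_norm \<Omega> v"
      using eq l2_Cauchy_Schwarz[OF w(1)] by (simp add: assoc_op_def)
    then show "ennreal (cmod (?F v) / l2_norm \<Omega> v) \<le> ennreal (l2_norm \<Omega> w)"
      using l2_norm_pos[of v] v by (intro ennreal_leI) (auto simp: field_simps)
  qed
  then obtain e where e: "dual_norm \<Omega> V ?F = ennreal e" "0 \<le> e" "e \<le> l2_norm \<Omega> w"
    using l2_norm_pos[OF w] by (cases "dual_norm \<Omega> V ?F") (auto simp: top_unique)
  \<comment> \<open>In \<open>ennreal\<close> a positive number divided by 0 is infinite, which the
    finite bound \<open>ennreal C\<close> excludes.\<close>
  have "e \<noteq> 0" using * u0 by (auto simp: e(1) ennreal_divide_zero top_unique)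
  with e have "0 < e" by simp
  \<comment> \<open>\<open>ennreal\<close> truncates a negative \<open>C\<close> to 0; as the
    quotient is positive, the inequality still passes to the reals.\<close>
  then have "l2_norm \<Omega> u / e \<le> C"
    using * u0 divide_pos_pos[OF u0 \<open>0 < e\<close>] by (auto simp: e(1) divide_ennreal ennreal_le_iff2)
  moreover have "l2_norm \<Omega> u / l2_norm \<Omega> w \<le> l2_norm \<Omega> u / e"
    using \<open>0 < e\<close> e(3) u0 by (intro divide_left_mono) auto
  ultimately have le: "l2_norm \<Omega> u / l2_norm \<Omega> w \<le> C" by (rule order_trans[rotated])
  have pos: "0 < l2_norm \<Omega> u / l2_norm \<Omega> w" using u0 l2_norm_pos[OF w] by simp
  show "0 < C" using pos le by (rule less_le_trans)
  show "l2_norm \<Omega> u \<le> C * l2_norm \<Omega> w"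
    using le l2_norm_pos[OF w] by (simp add: field_simps)
qed

text \<open>By surjectivity the functional of \<open>w\<close> is \<open>a u\<close> on
  \<open>V\<close> for some \<open>u\<close>, so the preceding bound applies. Any nonzero
  \<open>w\<close> in \<open>V\<close> serves, so one such function gives positivity of both
  constants.\<close>

lemma dual_op_norm_bound_pos:
  assumes "sesquilinear_on V a" "bij_betw (assoc_op V a) V (antidual V)"
    "dual_op_norm \<Omega> V (the_inv_into V (assoc_op V a)) \<le> ennreal C"
    and w: "w \<in> V" "w \<noteq> (\<lambda>_. 0)"
  shows "0 < C"
proof -
  have "assoc_op V (l2_inner \<Omega>) w \<in> antidual V"
    using sesquilinear_l2_inner w(1)
    by (simp add: assoc_op_in_antidual_iff add_mem scale_mem sesquilinear_on_def)
  then obtain u where u: "u \<in> V" "assoc_op V a u = assoc_op V (l2_inner \<Omega>) w"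
    using assms(2) unfolding bij_betw_def by (metis imageE)
  then have "a u v = l2_inner \<Omega> w v" if "v \<in> V" for v
    using that by (metis assoc_op_def restrict_apply')
  then show ?thesis using dual_op_norm_bound(1)[OF assms u(1)] by blast
qed

text \<open>Division by \<open>d\<close> turns the equation into
  \<open>a u = (m / d) (w, .)\<close>, to which the operator bound applies. That bound concerns
  nonzero right-hand sides; for \<open>w = 0\<close> injectivity of the operator gives
  \<open>u = 0\<close>.\<close>

lemma coupled_bound:
  assumes a: "sesquilinear_on V a" "bij_betw (assoc_op V a) V (antidual V)"
    "dual_op_norm \<Omega> V (the_inv_into V (assoc_op V a)) \<le> ennreal C"
    and u: "u \<in> V" and w: "w \<in> V" and d: "d \<noteq> 0" and m: "m \<noteq> 0"
    and eq: "\<And>v. v \<in> V \<Longrightarrow> d * a u v = m * l2_inner \<Omega> w v"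
  shows "w = (\<lambda>_. 0) \<Longrightarrow> u = (\<lambda>_. 0)"
    and "w \<noteq> (\<lambda>_. 0) \<Longrightarrow> cmod d * l2_norm \<Omega> u \<le> C * cmod m * l2_norm \<Omega> w"
proof -
  let ?w = "\<lambda>x. m / d * w x"
  have w': "?w \<in> V" using w by (rule scale_mem)
  have eq': "a u v = l2_inner \<Omega> ?w v" if "v \<in> V" for v
  proof -
    have "l2_inner \<Omega> ?w v = m / d * l2_inner \<Omega> w v"
      by (rule sesquilinear_on_simps(3)[OF sesquilinear_l2_inner w w that])
    then have "l2_inner \<Omega> ?w v = d * a u v / d" using eq[OF that] by simp
    then show ?thesis using d by simp
  qed
  show "u = (\<lambda>_. 0)" if "w = (\<lambda>_. 0)"
  proof -
    have "a u v = a (\<lambda>_. 0) v" if v: "v \<in> V" for v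
      using eq[OF v] d \<open>w = (\<lambda>_. 0)\<close> sesquilinear_on_zero[OF a(1) v]
        sesquilinear_on_zero[OF sesquilinear_l2_inner v] by simp
    then have "assoc_op V a u = assoc_op V a (\<lambda>_. 0)"
      unfolding assoc_op_def by (rule restrict_ext)
    then show ?thesis using a(2) u zero_mem by (auto simp: bij_betw_def dest: inj_onD)
  qed
  show "cmod d * l2_norm \<Omega> u \<le> C * cmod m * l2_norm \<Omega> w" if "w \<noteq> (\<lambda>_. 0)"
  proof -
    have "?w \<noteq> (\<lambda>_. 0)" using that d m by (auto simp: fun_eq_iff)
    then have "l2_norm \<Omega> u \<le> C * l2_norm \<Omega> ?w"
      using dual_op_norm_bound(2)[OF a w' _ u eq'] by blast
    also have "\<dots> = C * (cmod m / cmod d * l2_norm \<Omega> w)"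
      using l2_norm_scale[OF w, of "m / d"] by (simp add: norm_divide)
    finally show ?thesis using d by (simp add: field_simps)
  qed
qed

end


section \<open>The finite element space\<close>

lemma polynomials_zero: "(\<lambda>_. 0) \<in> polynomials k"
  unfolding polynomials_def by (auto intro!: exI[of _ "\<lambda>_. 0"])

lemma polynomials_add: "p \<in> polynomials k \<Longrightarrow> q \<in> polynomials k \<Longrightarrow> (\<lambda>x. p x + q x) \<in> polynomials k"
proof -
  assume "p \<in> polynomials k" "q \<in> polynomials k"
  then obtain c d where "\<And>x. p x = (\<Sum>\<alpha>\<in>multi_indices k. c \<alpha> * (\<Prod>b\<in>Basis. complex_of_real (x \<bullet> b) ^ \<alpha> b))"
    "\<And>x. q x = (\<Sum>\<alpha>\<in>multi_indices k. d \<alpha> * (\<Prod>b\<in>Basis. complex_of_real (x \<bullet> b) ^ \<alpha> b))"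
    unfolding polynomials_def by auto
  then show ?thesis
    unfolding polynomials_def
    by (auto intro!: exI[of _ "\<lambda>\<alpha>. c \<alpha> + d \<alpha>"] simp: distrib_right sum.distrib)
qed

lemma polynomials_scale: "p \<in> polynomials k \<Longrightarrow> (\<lambda>x. c * p x) \<in> polynomials k"
proof -
  assume "p \<in> polynomials k"
  then obtain d where "\<And>x. p x = (\<Sum>\<alpha>\<in>multi_indices k. d \<alpha> * (\<Prod>b\<in>Basis. complex_of_real (x \<bullet> b) ^ \<alpha> b))"
    unfolding polynomials_def by auto
  then show ?thesis
    unfolding polynomials_def
    by (auto intro!: exI[of _ "\<lambda>\<alpha>. c * d \<alpha>"] simp: sum_distrib_left mult.assoc)
qed

lemma continuous_function_space_fe_space:
  assumes "open \<Omega>" "bounded \<Omega>"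
  shows "continuous_function_space (fe_space k \<Omega> \<T>) \<Omega>"
proof
  show "(\<lambda>_. 0) \<in> fe_space k \<Omega> \<T>"
    using polynomials_zero by (fastforce simp: fe_space_def)
next
  fix u v assume uv: "u \<in> fe_space k \<Omega> \<T>" "v \<in> fe_space k \<Omega> \<T>"
  have "\<exists>p\<in>polynomials k. \<forall>x\<in>K. u x + v x = p x" if K: "K \<in> \<T>" for K
  proof -
    obtain p q where "p \<in> polynomials k" "q \<in> polynomials k" "\<forall>x\<in>K. u x = p x" "\<forall>x\<in>K. v x = q x"
      using uv K by (fastforce simp: fe_space_def)
    then show ?thesis by (intro bexI[of _ "\<lambda>x. p x + q x"] polynomials_add) auto
  qed
  then show "(\<lambda>x. u x + v x) \<in> fe_space k \<Omega> \<T>"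
    using uv by (auto simp: fe_space_def intro!: continuous_intros)
next
  fix u c assume u: "u \<in> fe_space k \<Omega> \<T>"
  have "\<exists>p\<in>polynomials k. \<forall>x\<in>K. c * u x = p x" if K: "K \<in> \<T>" for K
  proof -
    obtain p where "p \<in> polynomials k" "\<forall>x\<in>K. u x = p x"
      using u K by (fastforce simp: fe_space_def)
    then show ?thesis by (intro bexI[of _ "\<lambda>x. c * p x"] polynomials_scale) auto
  qed
  then show "(\<lambda>x. c * u x) \<in> fe_space k \<Omega> \<T>"
    using u by (auto simp: fe_space_def intro!: continuous_intros)
qed (use assms in \<open>auto simp: fe_space_def\<close>)


section \<open>Sesquilinearity of the forms of \<open>H\<^sub>T\<close> and \<open>H\<^sub>P\<close>\<close>

text \<open>
  Integrability of gradients and of boundary traces is never needed: antilinearity of the gradient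
  and boundary pairings in the second argument can be read off from the assumption that the
  associated operators map into the antidual, and linearity in the first argument then follows from
  Hermitian symmetry, which holds for arbitrary integrands.
\<close>

context continuous_function_space
begin

lemma sesquilinear_grad_inner:
  assumes "\<M> \<noteq> 0" "bij_betw (assoc_op V (form_T \<M> \<Omega>)) V (antidual V)"
  shows "sesquilinear_on V (grad_inner \<Omega>)"
proof (rule sesquilinear_on_hermitian[OF cnj_grad_inner])
  fix u assume u: "u \<in> V"
  \<comment> \<open>This is the definition of \<open>form_T\<close> solved for the gradient
    pairing.\<close>
  have "antilinear_on V (\<lambda>v. inverse (of_real \<M>) * form_T \<M> \<Omega> u v + \<i> / of_real \<M> * l2_inner \<Omega> u v)"
    using antilinear_on_of_bij[OF assms(2) u] sesquilinear_l2_inner u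
    by (intro antilinear_on_lincomb) (simp_all add: sesquilinear_on_def)
  also have "(\<lambda>v. inverse (of_real \<M>) * form_T \<M> \<Omega> u v + \<i> / of_real \<M> * l2_inner \<Omega> u v)
      = grad_inner \<Omega> u"
    using assms(1) by (auto simp: form_T_def field_simps)
  finally show "antilinear_on V (grad_inner \<Omega> u)" .
qed

lemma sesquilinear_form_T:
  assumes "\<M> \<noteq> 0" "bij_betw (assoc_op V (form_T \<M> \<Omega>)) V (antidual V)"
  shows "sesquilinear_on V (form_T \<M> \<Omega>)"
  using sesquilinear_on_lincomb[OF sesquilinear_grad_inner[OF assms] sesquilinear_l2_inner, of "of_real \<M>" "- \<i>"]
  by (simp add: form_T_def[abs_def])

lemma sesquilinear_form_P:
  assumes \<gamma>: "0 < \<gamma>" and grad: "sesquilinear_on V (grad_inner \<Omega>)"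
    and bij: "bij_betw (assoc_op V (form_P \<gamma> \<M> \<Lambda> \<Omega> \<Gamma>)) V (antidual V)"
  shows "sesquilinear_on V (form_P \<gamma> \<M> \<Lambda> \<Omega> \<Gamma>)"
proof -
  define z where "z = 1 - \<i> * complex_of_real (\<gamma> * \<Lambda>)"
  define s where "s = \<i> * complex_of_real (sqrt \<gamma>)"
  define c where "c = complex_of_real (\<gamma> * (1 - \<Lambda> / \<M>) - \<Lambda> / \<M>)"
  \<comment> \<open>The real part of \<open>z\<close> is 1.\<close>
  have z: "z \<noteq> 0" by (simp add: z_def complex_eq_iff)
  have s: "s \<noteq> 0" using \<gamma> by (simp add: s_def)
  have form: "form_P \<gamma> \<M> \<Lambda> \<Omega> \<Gamma> u v
      = z * (grad_inner \<Omega> u v - s * bdry_inner \<Gamma> u v) - c * l2_inner \<Omega> u v" for u v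
    by (simp add: form_P_def grad_inner_gamma_def z_def s_def c_def)
  have bdry: "sesquilinear_on V (bdry_inner \<Gamma>)"
  proof (rule sesquilinear_on_hermitian[OF cnj_bdry_inner])
    fix u assume u: "u \<in> V"
    \<comment> \<open>This is the expansion \<open>form\<close> solved for the boundary pairing; the
      factor 1 only nests two binary linear combinations.\<close>
    have "antilinear_on V (\<lambda>v. - 1 / (z * s) * form_P \<gamma> \<M> \<Lambda> \<Omega> \<Gamma> u v
        + 1 * (1 / s * grad_inner \<Omega> u v + (- c / (z * s)) * l2_inner \<Omega> u v))"
      using antilinear_on_of_bij[OF bij u] sesquilinear_l2_inner grad u
      by (intro antilinear_on_lincomb) (simp_all add: sesquilinear_on_def)
    also have "(\<lambda>v. - 1 / (z * s) * form_P \<gamma> \<M> \<Lambda> \<Omega> \<Gamma> u v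
        + 1 * (1 / s * grad_inner \<Omega> u v + (- c / (z * s)) * l2_inner \<Omega> u v)) = bdry_inner \<Gamma> u"
      using z s by (auto simp: form field_simps)
    finally show "antilinear_on V (bdry_inner \<Gamma> u)" .
  qed
  have "sesquilinear_on V (\<lambda>u v. z * grad_inner \<Omega> u v + 1 * (- z * s * bdry_inner \<Gamma> u v + - c * l2_inner \<Omega> u v))"
    by (intro sesquilinear_on_lincomb grad bdry sesquilinear_l2_inner)
  also have "(\<lambda>u v. z * grad_inner \<Omega> u v + 1 * (- z * s * bdry_inner \<Gamma> u v + - c * l2_inner \<Omega> u v))
      = form_P \<gamma> \<M> \<Lambda> \<Omega> \<Gamma>"
    by (auto simp: form fun_eq_iff algebra_simps)
  finally show ?thesis .
qed

section \<open>From block rows to variational equations\<close>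

text \<open>Each row is the variational equation tested with one basis function. Both sides are
  antilinear in the test function and the basis spans \<open>V\<close>, so the equation extends to
  all of \<open>V\<close>. The factor \<open>\<mu> - 1\<close> arises because the diagonal block
  stands on both sides.\<close>

lemma row_identity:
  fixes X Y :: "complex Matrix.vec"
  assumes a: "sesquilinear_on V a" and \<psi>: "is_basis V n \<psi>"
    and X: "X \<in> carrier_vec n" and Y: "Y \<in> carrier_vec n"
    and eq: "form_mat n \<psi> a *\<^sub>v X + (m \<cdot>\<^sub>m mass_mat \<Omega> n \<psi>) *\<^sub>v Y = \<mu> \<cdot>\<^sub>v (form_mat n \<psi> a *\<^sub>v X)"
    and v: "v \<in> V"
  shows "(\<mu> - 1) * a (\<lambda>x. \<Sum>j<n. X $ j * \<psi> j x) v = m * l2_inner \<Omega> (\<lambda>x. \<Sum>j<n. Y $ j * \<psi> j x) v"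
proof -
  let ?u = "\<lambda>x. \<Sum>j<n. X $ j * \<psi> j x" and ?w = "\<lambda>x. \<Sum>j<n. Y $ j * \<psi> j x"
  have mem: "\<psi> i \<in> V" if "i < n" for i using \<psi> that by (simp add: is_basis_def)
  have uw: "?u \<in> V" "?w \<in> V" by (auto intro!: sum_mem mem)
  have row: "(\<mu> - 1) * a ?u (\<psi> i) = m * l2_inner \<Omega> ?w (\<psi> i)" if i: "i < n" for i
  proof -
    have "((m \<cdot>\<^sub>m mass_mat \<Omega> n \<psi>) *\<^sub>v Y) $ i = m * (form_mat n \<psi> (l2_inner \<Omega>) *\<^sub>v Y) $ i"
      using i Y by (simp add: mass_mat_def form_mat_def scalar_prod_def sum_distrib_left mult.assoc)
    moreover have "(form_mat n \<psi> a *\<^sub>v X + (m \<cdot>\<^sub>m mass_mat \<Omega> n \<psi>) *\<^sub>v Y) $ i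
        = (form_mat n \<psi> a *\<^sub>v X) $ i + ((m \<cdot>\<^sub>m mass_mat \<Omega> n \<psi>) *\<^sub>v Y) $ i"
      using i by (simp add: mass_mat_def form_mat_def)
    moreover have "(\<mu> \<cdot>\<^sub>v (form_mat n \<psi> a *\<^sub>v X)) $ i = \<mu> * (form_mat n \<psi> a *\<^sub>v X) $ i"
      using i by (simp add: form_mat_def)
    ultimately have "a ?u (\<psi> i) + m * l2_inner \<Omega> ?w (\<psi> i) = \<mu> * a ?u (\<psi> i)"
      using arg_cong[OF eq, of "\<lambda>x. x $ i"]
        form_mat_mult_vec[OF a mem X i] form_mat_mult_vec[OF sesquilinear_l2_inner mem Y i] by simp
    then show ?thesis by (simp add: algebra_simps)
  qed
  obtain c where "v = (\<lambda>x. \<Sum>i<n. c i * \<psi> i x)"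
    using \<psi> v unfolding is_basis_def by (metis ext)
  then show ?thesis
    using row by (simp add: sesquilinear_on_sum(2)[OF a mem uw(1)]
        sesquilinear_on_sum(2)[OF sesquilinear_l2_inner mem uw(2)] sum_distrib_left mult.left_commute)
qed

end

lemma H_T_eq_form_mat: "H_T \<M> \<Omega> n \<psi> = form_mat n \<psi> (form_T \<M> \<Omega>)"
  by (rule eq_matI) (auto simp: H_T_def stiff_mat_def mass_mat_def form_mat_def form_T_def)

lemma H_P_eq_form_mat: "H_P \<gamma> \<M> \<Lambda> \<Omega> \<Gamma> n \<psi> = form_mat n \<psi> (form_P \<gamma> \<M> \<Lambda> \<Omega> \<Gamma>)"
  by (rule eq_matI) (auto simp: H_P_def stiff_gamma_mat_def mass_mat_def form_mat_def form_P_def)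

section \<open>The eigenvalue bound\<close>

theorem theorem4p1:
  fixes \<Omega> \<Gamma>\<^sub>a \<Gamma>\<^sub>w :: "'a::euclidean_space set"
    and \<TT> :: "'a set set set"
    and \<T> :: "'a set set"
    and k n :: nat
    and \<psi> :: "nat \<Rightarrow> 'a \<Rightarrow> complex"
    and \<gamma> \<M> \<Lambda> h\<^sub>0 C\<^sub>T C\<^sub>P :: real
    and \<mu> :: complex
    and T P :: "complex Matrix.vec"
  assumes "DIM('a) = 2 \<or> DIM('a) = 3"
    and "open \<Omega>" "connected \<Omega>" "bounded \<Omega>" "\<Omega> \<noteq> {}"
    and "frontier \<Omega> = \<Gamma>\<^sub>a \<union> \<Gamma>\<^sub>w" "\<Gamma>\<^sub>a \<in> sets borel" "\<Gamma>\<^sub>w \<in> sets borel"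
    and "1 < \<gamma>" "0 < \<M>" "0 < \<Lambda>" "\<Lambda> \<noteq> \<M>"
    and "1 \<le> k"
    and "\<And>\<S>. \<S> \<in> \<TT> \<Longrightarrow> triangulation_of \<Omega> \<S>"
    and "quasi_uniform \<TT>"
    and "0 < h\<^sub>0"
    and "\<And>\<S>. \<S> \<in> \<TT> \<Longrightarrow> mesh_size \<S> \<le> h\<^sub>0 \<Longrightarrow>
           (let V = fe_space k \<Omega> \<S>; A = assoc_op V (form_T \<M> \<Omega>)
            in bij_betw A V (antidual V) \<and> dual_op_norm \<Omega> V (the_inv_into V A) \<le> ennreal C\<^sub>T)"
    and "\<And>\<S>. \<S> \<in> \<TT> \<Longrightarrow> mesh_size \<S> \<le> h\<^sub>0 \<Longrightarrow>
           (let V = fe_space k \<Omega> \<S>; A = assoc_op V (form_P \<gamma> \<M> \<Lambda> \<Omega> \<Gamma>\<^sub>a)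
            in bij_betw A V (antidual V) \<and> dual_op_norm \<Omega> V (the_inv_into V A) \<le> ennreal C\<^sub>P)"
    and "\<T> \<in> \<TT>" "mesh_size \<T> \<le> h\<^sub>0"
    and "is_basis (fe_space k \<Omega> \<T>) n \<psi>"
    and "T \<in> carrier_vec n" "P \<in> carrier_vec n" "T @\<^sub>v P \<noteq> 0\<^sub>v (n + n)"
    and "four_block_mat (H_T \<M> \<Omega> n \<psi>) (M_1 \<gamma> \<Omega> n \<psi>)
                        (M_2 \<gamma> \<M> \<Lambda> \<Omega> n \<psi>) (H_P \<gamma> \<M> \<Lambda> \<Omega> \<Gamma>\<^sub>a n \<psi>) *\<^sub>v (T @\<^sub>v P) =
         \<mu> \<cdot>\<^sub>v (four_block_mat (H_T \<M> \<Omega> n \<psi>) (0\<^sub>m n n)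
                              (0\<^sub>m n n) (H_P \<gamma> \<M> \<Lambda> \<Omega> \<Gamma>\<^sub>a n \<psi>) *\<^sub>v (T @\<^sub>v P))"
  shows "\<mu> \<in> cball 1 (sqrt (C\<^sub>T * C\<^sub>P * (\<gamma> - 1) * \<bar>1 - \<Lambda> / \<M>\<bar>))"
proof -
  let ?V = "fe_space k \<Omega> \<T>"
  let ?aT = "form_T \<M> \<Omega>" and ?aP = "form_P \<gamma> \<M> \<Lambda> \<Omega> \<Gamma>\<^sub>a"
  interpret continuous_function_space ?V \<Omega>
    using assms by (intro continuous_function_space_fe_space)
  have opT: "bij_betw (assoc_op ?V ?aT) ?V (antidual ?V)"
      "dual_op_norm \<Omega> ?V (the_inv_into ?V (assoc_op ?V ?aT)) \<le> ennreal C\<^sub>T"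
    using assms(17)[OF assms(19,20)] by (simp_all add: Let_def)
  have opP: "bij_betw (assoc_op ?V ?aP) ?V (antidual ?V)"
      "dual_op_norm \<Omega> ?V (the_inv_into ?V (assoc_op ?V ?aP)) \<le> ennreal C\<^sub>P"
    using assms(18)[OF assms(19,20)] by (simp_all add: Let_def)
  have \<M>: "\<M> \<noteq> 0" and \<gamma>: "0 < \<gamma>" using \<open>0 < \<M>\<close> \<open>1 < \<gamma>\<close> by auto
  note sT = sesquilinear_form_T[OF \<M> opT(1)]
  note sP = sesquilinear_form_P[OF \<gamma> sesquilinear_grad_inner[OF \<M> opT(1)] opP(1)]
  define m\<^sub>1 where "m\<^sub>1 = \<i> * complex_of_real ((\<gamma> - 1) / \<gamma>)"
  define m\<^sub>2 where "m\<^sub>2 = complex_of_real (\<gamma> * (1 - \<Lambda> / \<M>))"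
  have m: "m\<^sub>1 \<noteq> 0" "m\<^sub>2 \<noteq> 0"
    using \<open>1 < \<gamma>\<close> \<M> \<open>\<Lambda> \<noteq> \<M>\<close> by (auto simp: m\<^sub>1_def m\<^sub>2_def)
  \<comment> \<open>The factor \<gamma> cancels between the two couplings, leaving the quantity in
    the radius.\<close>
  have m12: "cmod m\<^sub>1 * cmod m\<^sub>2 = (\<gamma> - 1) * \<bar>1 - \<Lambda> / \<M>\<bar>"
    using \<open>1 < \<gamma>\<close> by (simp add: m\<^sub>1_def m\<^sub>2_def norm_mult abs_mult del: of_real_divide of_real_diff of_real_mult)
  let ?AT = "form_mat n \<psi> ?aT" and ?AP = "form_mat n \<psi> ?aP" and ?M = "mass_mat \<Omega> n \<psi>"
  have carr: "form_mat n \<psi> b \<in> carrier_mat n n" "?M \<in> carrier_mat n n" for b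
    by (simp_all add: form_mat_def mass_mat_def)
  have carr': "m \<cdot>\<^sub>m ?M \<in> carrier_mat n n" for m using carr(2) by simp
  note vT = mult_mat_vec_carrier[OF carr(1) assms(22)] and vP = mult_mat_vec_carrier[OF carr(1) assms(23)]
  note vT' = mult_mat_vec_carrier[OF carr' assms(22)] and vP' = mult_mat_vec_carrier[OF carr' assms(23)]
  have "(?AT *\<^sub>v T + (m\<^sub>1 \<cdot>\<^sub>m ?M) *\<^sub>v P) @\<^sub>v ((m\<^sub>2 \<cdot>\<^sub>m ?M) *\<^sub>v T + ?AP *\<^sub>v P)
      = \<mu> \<cdot>\<^sub>v ((?AT *\<^sub>v T + 0\<^sub>m n n *\<^sub>v P) @\<^sub>v (0\<^sub>m n n *\<^sub>v T + ?AP *\<^sub>v P))"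
    using assms(25)
    unfolding H_T_eq_form_mat H_P_eq_form_mat M_1_def M_2_def m\<^sub>1_def[symmetric] m\<^sub>2_def[symmetric]
      four_block_mat_mult_vec[OF carr(1) carr' carr' carr(1) assms(22,23)]
      four_block_mat_mult_vec[OF carr(1) zero_carrier_mat zero_carrier_mat carr(1) assms(22,23)] .
  also have "\<dots> = (\<mu> \<cdot>\<^sub>v (?AT *\<^sub>v T)) @\<^sub>v (\<mu> \<cdot>\<^sub>v (?AP *\<^sub>v P))"
    using assms(22,23) by (intro eq_vecI) (auto simp: carrier_vecD form_mat_def scalar_prod_def)
  finally have blocks: "?AT *\<^sub>v T + (m\<^sub>1 \<cdot>\<^sub>m ?M) *\<^sub>v P = \<mu> \<cdot>\<^sub>v (?AT *\<^sub>v T) \<and>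
      (m\<^sub>2 \<cdot>\<^sub>m ?M) *\<^sub>v T + ?AP *\<^sub>v P = \<mu> \<cdot>\<^sub>v (?AP *\<^sub>v P)"
    by (simp only: append_vec_eq[OF add_carrier_vec[OF vT vP'] smult_carrier_vec[THEN iffD2, OF vT]])
  \<comment> \<open>The second row is reordered so that the diagonal block comes first, as
    \<open>row_identity\<close> expects.\<close>
  have rows: "?AT *\<^sub>v T + (m\<^sub>1 \<cdot>\<^sub>m ?M) *\<^sub>v P = \<mu> \<cdot>\<^sub>v (?AT *\<^sub>v T)"
      "?AP *\<^sub>v P + (m\<^sub>2 \<cdot>\<^sub>m ?M) *\<^sub>v T = \<mu> \<cdot>\<^sub>v (?AP *\<^sub>v P)"
    using blocks by (blast, simp only: comm_add_vec[OF vP vT'])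
  define u where "u x = (\<Sum>j<n. T $ j * \<psi> j x)" for x
  define w where "w x = (\<Sum>j<n. P $ j * \<psi> j x)" for x
  have uw: "u \<in> ?V" "w \<in> ?V"
    using assms(21) unfolding u_def[abs_def] w_def[abs_def] by (auto simp: is_basis_def intro!: sum_mem)
  have eqs: "(\<mu> - 1) * ?aT u v = m\<^sub>1 * l2_inner \<Omega> w v" "(\<mu> - 1) * ?aP w v = m\<^sub>2 * l2_inner \<Omega> u v"
    if "v \<in> ?V" for v
    using row_identity[OF sT assms(21-23) rows(1) that] row_identity[OF sP assms(21,23,22) rows(2) that]
    by (simp_all add: u_def[abs_def] w_def[abs_def])
  \<comment> \<open>Linear independence of the basis transfers the nonvanishing of the block vector
    to the pair of functions.\<close>
  have ne: "\<not> (u = (\<lambda>_. 0) \<and> w = (\<lambda>_. 0))"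
  proof
    assume "u = (\<lambda>_. 0) \<and> w = (\<lambda>_. 0)"
    then have "\<forall>x. (\<Sum>j<n. T $ j * \<psi> j x) = 0" "\<forall>x. (\<Sum>j<n. P $ j * \<psi> j x) = 0"
      by (auto simp: u_def w_def fun_eq_iff)
    then have "\<forall>j<n. T $ j = 0" "\<forall>j<n. P $ j = 0"
      using assms(21) unfolding is_basis_def by blast+
    then have "T @\<^sub>v P = 0\<^sub>v (n + n)"
      using assms(22,23) by (intro eq_vecI) (auto simp: carrier_vecD)
    then show False using assms(24) by contradiction
  qed
  have C: "0 < C\<^sub>T" "0 < C\<^sub>P"
    using ne uw dual_op_norm_bound_pos[OF sT opT] dual_op_norm_bound_pos[OF sP opP] by blast+
  have "(cmod (\<mu> - 1))\<^sup>2 \<le> C\<^sub>T * C\<^sub>P * (\<gamma> - 1) * \<bar>1 - \<Lambda> / \<M>\<bar>"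
  proof (cases "\<mu> = 1")
    \<comment> \<open>What remains is that the product under the root is nonnegative, which follows
      from positivity of \<open>C\<^sub>T\<close> and \<open>C\<^sub>P\<close>.\<close>
    case True
    then show ?thesis using C \<open>1 < \<gamma>\<close> by simp
  next
    case False
    then have d: "\<mu> - 1 \<noteq> 0" by simp
    \<comment> \<open>If either function vanished, its row equation would force the other to vanish
      too, against \<open>ne\<close>.\<close>
    have nz: "u \<noteq> (\<lambda>_. 0)" "w \<noteq> (\<lambda>_. 0)"
      using coupled_bound(1)[OF sT opT uw d m(1)] coupled_bound(1)[OF sP opP uw(2,1) d m(2)] eqs ne
      by blast+
    have boundT: "cmod (\<mu> - 1) * l2_norm \<Omega> u \<le> C\<^sub>T * cmod m\<^sub>1 * l2_norm \<Omega> w"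
      using coupled_bound(2)[OF sT opT uw d m(1)] eqs(1) nz(2) by blast
    have boundP: "cmod (\<mu> - 1) * l2_norm \<Omega> w \<le> C\<^sub>P * cmod m\<^sub>2 * l2_norm \<Omega> u"
      using coupled_bound(2)[OF sP opP uw(2,1) d m(2)] eqs(2) nz(1) by blast
    have pos: "0 < l2_norm \<Omega> u" "0 < l2_norm \<Omega> w" using uw nz by (auto intro: l2_norm_pos)
    have "(cmod (\<mu> - 1) * l2_norm \<Omega> u) * (cmod (\<mu> - 1) * l2_norm \<Omega> w)
        \<le> (C\<^sub>T * cmod m\<^sub>1 * l2_norm \<Omega> w) * (C\<^sub>P * cmod m\<^sub>2 * l2_norm \<Omega> u)"
      using C pos by (intro mult_mono boundT boundP) auto
    then have "(cmod (\<mu> - 1))\<^sup>2 * (l2_norm \<Omega> u * l2_norm \<Omega> w)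
        \<le> (C\<^sub>T * C\<^sub>P * (cmod m\<^sub>1 * cmod m\<^sub>2)) * (l2_norm \<Omega> u * l2_norm \<Omega> w)"
      by (simp add: power2_eq_square mult_ac)
    then have "(cmod (\<mu> - 1))\<^sup>2 \<le> C\<^sub>T * C\<^sub>P * (cmod m\<^sub>1 * cmod m\<^sub>2)"
      using pos by (simp add: mult_le_cancel_right)
    then show ?thesis by (simp add: m12 mult.assoc)
  qed
  then show ?thesis
    by (simp add: dist_norm norm_minus_commute real_le_rsqrt)
qed

end
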